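(* Let $D$ be the $n$-th qubit of an $n$-qubit system and let $A$ be any other single-qubit system (so $d_A=2$). Let $\mathbb{E}_A$ denote the uniform average over all such systems $A$. In the large $n$ limit, the decoding fidelity $F(U_{\mathrm{bh}})$ and the Pauli growth $G(U_{\mathrm{bh}})$ of an $n$-qubit unitary $U_{\mathrm{bh}}$ satisfy the inequality $$\mathbb{E}_A\frac{1}{F(U_{\mathrm{bh}})}\ \ge\ (d_A^2-1)\Big[1-\frac{4}{3n}\big(G(U_{\mathrm{bh}})+1\big)\Big]+1 .$$
   Context: $n$-qubit Pauli operators are $n$-fold tensor products $P$ of single-qubit operators from $\{I,X,Y,Z\}$; the Pauli weight $|P|$ is the number of non-identity tensor factors. For a $2^n\times2^n$ matrix $M$, $\langle M\rangle=\frac{1}{2^n}\mathrm{Tr}(M)$, and $\|M\|_2=\sqrt{\langle M^\dagger M\rangle}$. $d_A$ is the Hilbert space dimension of $A$. Average Pauli weight: for an $n$-qubit operator $O$ with $\|O\|_2=1$ and Pauli expansion $O=\sum_P c_PP$, $W(O)=\sum_P|P|\,|c_P|^2$. Pauli growth of an $n$-qubit unitary $U$: $$G(U)=\max\{\,W(U^\dagger OU)-1 \;:\; \|O\|_2=1,\ W(O)=1,\ \mathrm{Tr}(O)=0\,\},$$ with $O$ ranging over $n$-qubit operators. $P_A$ (resp. $P_D$) denotes a Pauli operator acting non-trivially only on qubit $A$ (resp. $D$), i.e. equal to the identity on all other qubits; $\mathrm{OTOC}(U)=\langle U^\dagger P_DUP_AU^\dagger P_DUP_A\rangle$; $\mathbb{E}_{P_A,P_D}$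 is the uniform average over all Pauli operators on $A$ and all Pauli operators on $D$ (identity included). The decoding fidelity $F(U_{\mathrm{bh}})$ (which depends on $A$) is that of the teleportation-based decoding protocol for the Hayden–Preskill thought experiment, in which a state on $A$ is thrown into a black hole with dynamics $U_{\mathrm{bh}}$ and $D$ is the radiation emitted afterwards. It is determined by the average OTOC through $$\mathbb{E}_{P_A,P_D}\mathrm{OTOC}(U_{\mathrm{bh}})=\frac{1}{d_A^2\,F(U_{\mathrm{bh}})} .$$ *)

theory Defs
  imports
    "Jordan_Normal_Form.Schur_Decomposition"
    "HOL-Analysis.Function_Topology"
begin

section \<open>Pauli operators on \<open>n\<close> qubits\<close>

definition kronecker :: "complex mat \<Rightarrow> complex mat \<Rightarrow> complex mat" where
  "kronecker A B = mat (dim_row A * dim_row B) (dim_col A * dim_col B)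
     (\<lambda>(i, j). A $$ (i div dim_row B, j div dim_col B) * B $$ (i mod dim_row B, j mod dim_col B))"

datatype pauli = Pauli_I | Pauli_X | Pauli_Y | Pauli_Z

fun pauli_mat :: "pauli \<Rightarrow> complex mat" where
  "pauli_mat Pauli_I = mat_of_rows_list 2 [[1, 0], [0, 1]]"
| "pauli_mat Pauli_X = mat_of_rows_list 2 [[0, 1], [1, 0]]"
| "pauli_mat Pauli_Y = mat_of_rows_list 2 [[0, - \<i>], [\<i>, 0]]"
| "pauli_mat Pauli_Z = mat_of_rows_list 2 [[1, 0], [0, - 1]]"

text \<open>An \<open>n\<close>-qubit Pauli operator is given by the list of its \<open>n\<close> tensor factors. Qubits are
  therefore numbered \<open>0, \<dots>, n - 1\<close>, and the \<open>n\<close>-th qubit has number \<open>n - 1\<close>.\<close>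

primrec pauli_string :: "pauli list \<Rightarrow> complex mat" where
  "pauli_string [] = 1\<^sub>m 1"
| "pauli_string (p # ps) = kronecker (pauli_mat p) (pauli_string ps)"

definition pauli_strings :: "nat \<Rightarrow> pauli list set" where
  "pauli_strings n = {ps. length ps = n}"

definition pauli_weight :: "pauli list \<Rightarrow> nat" where
  "pauli_weight ps = length (filter (\<lambda>p. p \<noteq> Pauli_I) ps)"

definition local_paulis :: "nat \<Rightarrow> nat \<Rightarrow> pauli list set" where
  "local_paulis n k = {ps \<in> pauli_strings n. \<forall>j<n. j \<noteq> k \<longrightarrow> ps ! j = Pauli_I}"


section \<open>Operators, normalised trace and norm\<close>

abbreviation operators :: "nat \<Rightarrow> complex mat set" where
  "operators n \<equiv> carrier_mat (2 ^ n) (2 ^ n)"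

definition unitaries :: "nat \<Rightarrow> complex mat set" where
  "unitaries n = {U \<in> operators n. mat_adjoint U * U = 1\<^sub>m (2 ^ n) \<and> U * mat_adjoint U = 1\<^sub>m (2 ^ n)}"

definition mat_trace :: "complex mat \<Rightarrow> complex" where
  "mat_trace M = (\<Sum>i<dim_row M. M $$ (i, i))"

definition ntrace :: "nat \<Rightarrow> complex mat \<Rightarrow> complex" where
  "ntrace n M = mat_trace M / 2 ^ n"

definition norm2 :: "nat \<Rightarrow> complex mat \<Rightarrow> real" where
  "norm2 n M = sqrt (Re (ntrace n (mat_adjoint M * M)))"


section \<open>Average Pauli weight and Pauli growth\<close>

definition pauli_sum :: "nat \<Rightarrow> (pauli list \<Rightarrow> complex) \<Rightarrow> complex mat" where
  "pauli_sum n c = mat (2 ^ n) (2 ^ n) (\<lambda>ij. \<Sum>ps\<in>pauli_strings n. c ps * pauli_string ps $$ ij)"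

text \<open>The coefficients of the Pauli expansion. They exist and are unique
  (\<open>pauli_expansion_unique\<close> below); outside of \<open>pauli_strings n\<close> they are set to \<open>0\<close>.\<close>

definition pauli_coeff :: "nat \<Rightarrow> complex mat \<Rightarrow> pauli list \<Rightarrow> complex" where
  "pauli_coeff n M = (THE c. M = pauli_sum n c \<and> (\<forall>ps. ps \<notin> pauli_strings n \<longrightarrow> c ps = 0))"

definition avg_weight :: "nat \<Rightarrow> complex mat \<Rightarrow> real" where
  "avg_weight n M = (\<Sum>ps\<in>pauli_strings n. real (pauli_weight ps) * (cmod (pauli_coeff n M ps))\<^sup>2)"

definition one_body_operators :: "nat \<Rightarrow> complex mat set" where
  "one_body_operators n = {M \<in> operators n. norm2 n M = 1 \<and> avg_weight n M = 1 \<and> mat_trace M = 0}"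

text \<open>The supremum is a maximum for \<open>n \<ge> 1\<close>, see \<open>pauli_growth_attained\<close> below.\<close>

definition pauli_growth :: "nat \<Rightarrow> complex mat \<Rightarrow> real" where
  "pauli_growth n U = (SUP M\<in>one_body_operators n. avg_weight n (mat_adjoint U * M * U) - 1)"


section \<open>Out-of-time-order correlators and decoding fidelity\<close>

definition OTOC :: "nat \<Rightarrow> complex mat \<Rightarrow> complex mat \<Rightarrow> complex mat \<Rightarrow> complex" where
  "OTOC n U P\<^sub>D P\<^sub>A = ntrace n (mat_adjoint U * P\<^sub>D * U * P\<^sub>A * mat_adjoint U * P\<^sub>D * U * P\<^sub>A)"

definition avg_OTOC :: "nat \<Rightarrow> nat \<Rightarrow> nat \<Rightarrow> complex mat \<Rightarrow> complex" where
  "avg_OTOC n A D U = (\<Sum>p\<in>local_paulis n A. \<Sum>q\<in>local_paulis n D.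
      OTOC n U (pauli_string q) (pauli_string p)) / (card (local_paulis n A) * card (local_paulis n D))"

text \<open>The dimension of the single-qubit system \<open>A\<close>.\<close>

definition d\<^sub>A :: real where
  "d\<^sub>A = 2"

text \<open>The fidelity is determined by the relation
  \<open>avg_OTOC n A D U = 1 / (d\<^sub>A\<^sup>2 * decoding_fidelity n A D U)\<close>, which is solved here for the fidelity
  and recovered in \<open>avg_OTOC_eq_fidelity\<close>. Taking the real part loses nothing, as the average is
  real for unitary \<open>U\<close>.\<close>

definition decoding_fidelity :: "nat \<Rightarrow> nat \<Rightarrow> nat \<Rightarrow> complex mat \<Rightarrow> real" where
  "decoding_fidelity n A D U = 1 / (d\<^sub>A\<^sup>2 * Re (avg_OTOC n A D U))"


section \<open>Well-definedness of the notions above\<close>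

lemma dim_mat_adjoint [simp]:
  "dim_row (mat_adjoint M) = dim_col M" "dim_col (mat_adjoint M) = dim_row M"
  by (simp_all add: mat_adjoint_def)

lemma index_mat_adjoint [simp]:
  "i < dim_col M \<Longrightarrow> j < dim_row M \<Longrightarrow> mat_adjoint M $$ (i, j) = cnj (M $$ (j, i))"
  for M :: "complex mat"
  by (simp add: mat_adjoint_def mat_of_rows_index)

lemma mat_adjoint_carrier [simp]:
  "M \<in> carrier_mat a b \<Longrightarrow> mat_adjoint M \<in> carrier_mat b a"
  by auto

lemma mat_adjoint_adjoint [simp]: "mat_adjoint (mat_adjoint M) = M" for M :: "complex mat"
  by (rule eq_matI) auto

lemma mat_adjoint_mult:
  fixes M N :: "complex mat"
  assumes "dim_col M = dim_row N"
  shows "mat_adjoint (M * N) = mat_adjoint N * mat_adjoint M"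
  using assms
  by (intro eq_matI) (auto simp: scalar_prod_def mult.commute intro!: sum.cong)

lemma mat_trace_adjoint: "dim_row M = dim_col M \<Longrightarrow> mat_trace (mat_adjoint M) = cnj (mat_trace M)"
  by (simp add: mat_trace_def)

lemma mat_trace_mult:
  assumes "dim_row M = dim_col N" "dim_col M = dim_row N"
  shows "mat_trace (M * N) = (\<Sum>i<dim_row M. \<Sum>k<dim_col M. M $$ (i, k) * N $$ (k, i))"
  using assms by (auto simp: mat_trace_def scalar_prod_def lessThan_atLeast0 intro!: sum.cong)

lemma mat_trace_commute:
  assumes "dim_row M = dim_col N" "dim_col M = dim_row N"
  shows "mat_trace (M * N) = mat_trace (N * M)"
proof -
  have "mat_trace (M * N) = (\<Sum>i<dim_row M. \<Sum>k<dim_col M. M $$ (i, k) * N $$ (k, i))"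
    using assms by (rule mat_trace_mult)
  also have "\<dots> = (\<Sum>k<dim_col M. \<Sum>i<dim_row M. M $$ (i, k) * N $$ (k, i))"
    by (rule sum.swap)
  also have "\<dots> = mat_trace (N * M)"
    using assms by (simp add: mat_trace_mult mult.commute)
  finally show ?thesis .
qed

lemma dim_kronecker [simp]:
  "dim_row (kronecker A B) = dim_row A * dim_row B"
  "dim_col (kronecker A B) = dim_col A * dim_col B"
  by (simp_all add: kronecker_def)

lemma dim_pauli_mat [simp]: "dim_row (pauli_mat p) = 2" "dim_col (pauli_mat p) = 2"
  by (cases p; simp add: mat_of_rows_list_def)+

lemma dim_pauli_string [simp]:
  "dim_row (pauli_string ps) = 2 ^ length ps" "dim_col (pauli_string ps) = 2 ^ length ps"
  by (induction ps) auto

lemma pauli_string_carrier: "ps \<in> pauli_strings n \<Longrightarrow> pauli_string ps \<in> operators n"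
  by (auto simp: pauli_strings_def)

lemma div_less_two: "i < 2 * m \<Longrightarrow> i div m < 2" for i m :: nat
  by (simp add: less_mult_imp_div_less)

lemma index_pauli_Cons:
  "i < 2 * 2 ^ length ps \<Longrightarrow> j < 2 * 2 ^ length ps \<Longrightarrow>
   pauli_string (p # ps) $$ (i, j) =
     pauli_mat p $$ (i div 2 ^ length ps, j div 2 ^ length ps) *
     pauli_string ps $$ (i mod 2 ^ length ps, j mod 2 ^ length ps)"
  by (simp add: kronecker_def)

lemma pauli_mat_hermitian:
  "i < 2 \<Longrightarrow> j < 2 \<Longrightarrow> cnj (pauli_mat p $$ (j, i)) = pauli_mat p $$ (i, j)"
  by (cases p) (auto simp: less_2_cases_iff mat_of_rows_list_def)

lemma pauli_string_hermitian_index: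
  "i < 2 ^ length ps \<Longrightarrow> j < 2 ^ length ps \<Longrightarrow>
   cnj (pauli_string ps $$ (j, i)) = pauli_string ps $$ (i, j)"
proof (induction ps arbitrary: i j)
  case (Cons p ps)
  then show ?case
    by (simp add: index_pauli_Cons pauli_mat_hermitian div_less_two del: pauli_string.simps)
qed auto

lemma pauli_string_hermitian [simp]: "mat_adjoint (pauli_string ps) = pauli_string ps"
  by (rule eq_matI) (auto simp: pauli_string_hermitian_index)

lemma UNIV_pauli: "UNIV = {Pauli_I, Pauli_X, Pauli_Y, Pauli_Z}"
  using pauli.exhaust by auto

instance pauli :: finite
  by standard (simp add: UNIV_pauli)

lemma finite_pauli_strings [simp]: "finite (pauli_strings n)"
  using finite_lists_length_eq[of "UNIV :: pauli set" n] by (simp add: pauli_strings_def)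

lemma sum_pauli_strings_Suc:
  "(\<Sum>ps\<in>pauli_strings (Suc n). f ps) = (\<Sum>p\<in>UNIV. \<Sum>ps\<in>pauli_strings n. f (p # ps))"
proof -
  have "pauli_strings (Suc n) = (\<lambda>(p, ps). p # ps) ` (UNIV \<times> pauli_strings n)"
    by (auto simp: pauli_strings_def length_Suc_conv image_iff)
  moreover have "inj_on (\<lambda>(p, ps). p # ps) (UNIV \<times> pauli_strings n)"
    by (auto simp: inj_on_def)
  ultimately show ?thesis
    by (simp add: sum.reindex sum.cartesian_product case_prod_unfold)
qed

lemma sum_div_mod:
  "(\<Sum>i<2 * m. f (i div m) (i mod m)) = (\<Sum>a<2. \<Sum>b<m. f a b)" for m :: nat
proof (cases "m = 0")
  case False
  have lt: "a * m + b < 2 * m" if "a < 2" "b < m" for a b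
    using that by (auto simp: less_2_cases_iff)
  have "(\<Sum>i<2 * m. f (i div m) (i mod m)) = (\<Sum>(a, b)\<in>{..<2} \<times> {..<m}. f a b)"
    using False
    by (intro sum.reindex_bij_witness[where i = "\<lambda>(a, b). a * m + b" and j = "\<lambda>i. (i div m, i mod m)"])
       (use lt in \<open>auto simp: div_less_two\<close>)
  then show ?thesis by (simp add: sum.cartesian_product)
qed auto

lemma sum_lessThan_2: "(\<Sum>a<2. f a) = f 0 + f (1 :: nat)"
  by (simp add: numeral_2_eq_2)

lemma pauli_mat_complete:
  assumes "i < 2" "j < 2" "k < 2" "l < 2"
  shows "(\<Sum>p\<in>UNIV. cnj (pauli_mat p $$ (i, j)) * pauli_mat p $$ (k, l)) = (if i = k \<and> j = l then 2 else 0)"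
  using assms by (auto simp: UNIV_pauli less_2_cases_iff mat_of_rows_list_def)

lemma pauli_mat_orthogonal:
  "(\<Sum>i<2. \<Sum>j<2. cnj (pauli_mat p $$ (i, j)) * pauli_mat q $$ (i, j)) = (if p = q then 2 else 0)"
  by (cases p; cases q) (auto simp: sum_lessThan_2 mat_of_rows_list_def)

lemma pauli_string_complete:
  assumes "i < 2 ^ n" "j < 2 ^ n" "k < 2 ^ n" "l < 2 ^ n"
  shows "(\<Sum>ps\<in>pauli_strings n. cnj (pauli_string ps $$ (i, j)) * pauli_string ps $$ (k, l))
       = (if i = k \<and> j = l then 2 ^ n else 0)"
  using assms
proof (induction n arbitrary: i j k l)
  case 0
  then show ?case by (simp add: pauli_strings_def)
next
  case (Suc n)
  let ?m = "2 ^ n :: nat"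
  have lt: "i < 2 * ?m" "j < 2 * ?m" "k < 2 * ?m" "l < 2 * ?m"
    using Suc.prems by simp_all
  have eq: "a = b \<longleftrightarrow> a div ?m = b div ?m \<and> a mod ?m = b mod ?m" for a b
    by (metis div_mult_mod_eq)
  have "(\<Sum>ps\<in>pauli_strings (Suc n). cnj (pauli_string ps $$ (i, j)) * pauli_string ps $$ (k, l))
      = (\<Sum>p\<in>UNIV. \<Sum>ps\<in>pauli_strings n.
          (cnj (pauli_mat p $$ (i div ?m, j div ?m)) * pauli_mat p $$ (k div ?m, l div ?m)) *
          (cnj (pauli_string ps $$ (i mod ?m, j mod ?m)) * pauli_string ps $$ (k mod ?m, l mod ?m)))"
    unfolding sum_pauli_strings_Suc
  proof (intro sum.cong refl)
    fix p ps assume "ps \<in> pauli_strings n"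
    then have "length ps = n" by (simp add: pauli_strings_def)
    then show "cnj (pauli_string (p # ps) $$ (i, j)) * pauli_string (p # ps) $$ (k, l) =
      (cnj (pauli_mat p $$ (i div ?m, j div ?m)) * pauli_mat p $$ (k div ?m, l div ?m)) *
      (cnj (pauli_string ps $$ (i mod ?m, j mod ?m)) * pauli_string ps $$ (k mod ?m, l mod ?m))"
      using lt by (simp add: index_pauli_Cons del: pauli_string.simps)
  qed
  also have "\<dots> = (if i div ?m = k div ?m \<and> j div ?m = l div ?m then 2 else 0) *
                  (if i mod ?m = k mod ?m \<and> j mod ?m = l mod ?m then 2 ^ n else 0)"
    using lt by (simp add: sum_product[symmetric] pauli_mat_complete Suc.IH div_less_two)
  also have "\<dots> = (if i = k \<and> j = l then 2 ^ Suc n else 0)"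
    using eq[of i k] eq[of j l] by auto
  finally show ?case .
qed

lemma pauli_string_orthogonal:
  assumes "length ps = n" "length qs = n"
  shows "(\<Sum>i<2 ^ n. \<Sum>j<2 ^ n. cnj (pauli_string ps $$ (i, j)) * pauli_string qs $$ (i, j))
       = (if ps = qs then 2 ^ n else 0)"
  using assms
proof (induction n arbitrary: ps qs)
  case 0
  then show ?case by simp
next
  case (Suc n)
  obtain p ps' q qs' where pq: "ps = p # ps'" "qs = q # qs'" "length ps' = n" "length qs' = n"
    using Suc.prems by (auto simp: length_Suc_conv)
  let ?m = "2 ^ n :: nat"
  let ?f = "\<lambda>a b. cnj (pauli_mat p $$ (a, b)) * pauli_mat q $$ (a, b)"
  let ?g = "\<lambda>a b. cnj (pauli_string ps' $$ (a, b)) * pauli_string qs' $$ (a, b)"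
  have "(\<Sum>i<2 ^ Suc n. \<Sum>j<2 ^ Suc n. cnj (pauli_string ps $$ (i, j)) * pauli_string qs $$ (i, j))
      = (\<Sum>i<2 * ?m. \<Sum>j<2 * ?m. ?f (i div ?m) (j div ?m) * ?g (i mod ?m) (j mod ?m))"
    unfolding pq power_Suc
    by (intro sum.cong refl) (simp add: pq index_pauli_Cons del: pauli_string.simps)
  also have "\<dots> = (\<Sum>i<2 * ?m. \<Sum>a<2. \<Sum>b<?m. ?f (i div ?m) a * ?g (i mod ?m) b)"
    by (intro sum.cong refl sum_div_mod[where f = "\<lambda>a b. ?f _ a * ?g _ b"])
  also have "\<dots> = (\<Sum>c<2. \<Sum>d<?m. \<Sum>a<2. \<Sum>b<?m. ?f c a * ?g d b)"
    by (rule sum_div_mod[where f = "\<lambda>c d. \<Sum>a<2. \<Sum>b<?m. ?f c a * ?g d b"])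
  also have "\<dots> = (\<Sum>c<2. \<Sum>a<2. ?f c a) * (\<Sum>d<?m. \<Sum>b<?m. ?g d b)"
    by (simp only: sum_product)
  also have "\<dots> = (if p = q then 2 else 0) * (if ps' = qs' then 2 ^ n else 0)"
    using pq by (simp only: pauli_mat_orthogonal Suc.IH)
  finally show ?case using pq by auto
qed

lemma ntrace_pauli_mult:
  assumes "ps \<in> pauli_strings n" "M \<in> operators n"
  shows "ntrace n (mat_adjoint (pauli_string ps) * M)
       = (\<Sum>i<2 ^ n. \<Sum>j<2 ^ n. cnj (pauli_string ps $$ (i, j)) * M $$ (i, j)) / 2 ^ n"
proof -
  have len: "length ps = n" using assms by (simp add: pauli_strings_def)
  have "mat_trace (mat_adjoint (pauli_string ps) * M)
      = (\<Sum>j<2 ^ n. \<Sum>i<2 ^ n. mat_adjoint (pauli_string ps) $$ (j, i) * M $$ (i, j))"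
    using assms len by (subst mat_trace_mult) (auto simp del: pauli_string_hermitian)
  also have "\<dots> = (\<Sum>j<2 ^ n. \<Sum>i<2 ^ n. cnj (pauli_string ps $$ (i, j)) * M $$ (i, j))"
    using len by (intro sum.cong refl) (simp del: pauli_string_hermitian)
  also have "\<dots> = (\<Sum>i<2 ^ n. \<Sum>j<2 ^ n. cnj (pauli_string ps $$ (i, j)) * M $$ (i, j))"
    by (rule sum.swap)
  finally show ?thesis by (simp add: ntrace_def)
qed

lemma pauli_sum_carrier [simp]: "pauli_sum n c \<in> operators n"
  by (simp add: pauli_sum_def)

lemma ntrace_pauli_sum:
  assumes "ps \<in> pauli_strings n"
  shows "ntrace n (mat_adjoint (pauli_string ps) * pauli_sum n c) = c ps"
proof -
  have "(\<Sum>i<2 ^ n. \<Sum>j<2 ^ n. cnj (pauli_string ps $$ (i, j)) * pauli_sum n c $$ (i, j))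
      = (\<Sum>i<2 ^ n. \<Sum>j<2 ^ n. \<Sum>qs\<in>pauli_strings n.
           c qs * (cnj (pauli_string ps $$ (i, j)) * pauli_string qs $$ (i, j)))"
    by (intro sum.cong refl) (simp add: pauli_sum_def sum_distrib_left mult_ac)
  also have "\<dots> = (\<Sum>i<2 ^ n. \<Sum>qs\<in>pauli_strings n. \<Sum>j<2 ^ n.
           c qs * (cnj (pauli_string ps $$ (i, j)) * pauli_string qs $$ (i, j)))"
    by (intro sum.cong refl sum.swap)
  also have "\<dots> = (\<Sum>qs\<in>pauli_strings n. \<Sum>i<2 ^ n. \<Sum>j<2 ^ n.
           c qs * (cnj (pauli_string ps $$ (i, j)) * pauli_string qs $$ (i, j)))"
    by (rule sum.swap)
  also have "\<dots> = (\<Sum>qs\<in>pauli_strings n. c qs * (if ps = qs then 2 ^ n else 0))"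
  proof (intro sum.cong refl)
    fix qs assume "qs \<in> pauli_strings n"
    then show "(\<Sum>i<2 ^ n. \<Sum>j<2 ^ n. c qs * (cnj (pauli_string ps $$ (i, j)) * pauli_string qs $$ (i, j)))
      = c qs * (if ps = qs then 2 ^ n else 0)"
      using assms by (simp only: sum_distrib_left[symmetric] pauli_strings_def mem_Collect_eq
          pauli_string_orthogonal)
  qed
  also have "\<dots> = (\<Sum>qs\<in>pauli_strings n. if ps = qs then c qs * 2 ^ n else 0)"
    by (intro sum.cong) auto
  also have "\<dots> = c ps * 2 ^ n"
    using assms by simp
  finally show ?thesis
    using assms by (simp add: ntrace_pauli_mult del: pauli_string_hermitian)
qed

lemma pauli_expansion:
  assumes "M \<in> operators n"
  shows "M = pauli_sum n (\<lambda>ps. if ps \<in> pauli_strings n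
           then ntrace n (mat_adjoint (pauli_string ps) * M) else 0)"
    (is "_ = pauli_sum n ?c")
proof (rule eq_matI)
  fix k l assume "k < dim_row (pauli_sum n ?c)" "l < dim_col (pauli_sum n ?c)"
  then have kl: "k < 2 ^ n" "l < 2 ^ n" by (simp_all add: pauli_sum_def)
  have "pauli_sum n ?c $$ (k, l)
      = (\<Sum>ps\<in>pauli_strings n. (\<Sum>i<2 ^ n. \<Sum>j<2 ^ n. M $$ (i, j) *
          (cnj (pauli_string ps $$ (i, j)) * pauli_string ps $$ (k, l)) / 2 ^ n))"
    unfolding pauli_sum_def using kl assms
    by (simp add: ntrace_pauli_mult sum_distrib_left sum_distrib_right sum_divide_distrib mult_ac
        del: pauli_string_hermitian)
  also have "\<dots> = (\<Sum>i<2 ^ n. \<Sum>ps\<in>pauli_strings n. \<Sum>j<2 ^ n. M $$ (i, j) *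
          (cnj (pauli_string ps $$ (i, j)) * pauli_string ps $$ (k, l)) / 2 ^ n)"
    by (rule sum.swap)
  also have "\<dots> = (\<Sum>i<2 ^ n. \<Sum>j<2 ^ n. \<Sum>ps\<in>pauli_strings n. M $$ (i, j) *
          (cnj (pauli_string ps $$ (i, j)) * pauli_string ps $$ (k, l)) / 2 ^ n)"
    by (intro sum.cong refl sum.swap)
  also have "\<dots> = (\<Sum>i<2 ^ n. \<Sum>j<2 ^ n. M $$ (i, j) * (if i = k \<and> j = l then 2 ^ n else 0) / 2 ^ n)"
    using kl by (intro sum.cong refl)
      (simp only: sum_distrib_left[symmetric] sum_divide_distrib[symmetric] lessThan_iff
        pauli_string_complete)
  also have "\<dots> = (\<Sum>i<2 ^ n. \<Sum>j<2 ^ n. if j = l then if i = k then M $$ (i, j) else 0 else 0)"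
    by (intro sum.cong refl) auto
  also have "\<dots> = M $$ (k, l)"
    using kl by simp
  finally show "M $$ (k, l) = pauli_sum n ?c $$ (k, l)" by simp
qed (use assms in \<open>auto simp: pauli_sum_def\<close>)

theorem pauli_expansion_unique:
  assumes "M \<in> operators n"
  shows "\<exists>!c. M = pauli_sum n c \<and> (\<forall>ps. ps \<notin> pauli_strings n \<longrightarrow> c ps = 0)"
proof (rule ex1I, intro conjI)
  show "M = pauli_sum n (\<lambda>ps. if ps \<in> pauli_strings n
           then ntrace n (mat_adjoint (pauli_string ps) * M) else 0)"
    using assms by (rule pauli_expansion)
next
  fix c assume c: "M = pauli_sum n c \<and> (\<forall>ps. ps \<notin> pauli_strings n \<longrightarrow> c ps = 0)"
  then show "c = (\<lambda>ps. if ps \<in> pauli_strings n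
           then ntrace n (mat_adjoint (pauli_string ps) * M) else 0)"
    using ntrace_pauli_sum by auto
qed auto

theorem pauli_coeff_eq:
  assumes "M \<in> operators n"
  shows "pauli_coeff n M ps =
    (if ps \<in> pauli_strings n then ntrace n (mat_adjoint (pauli_string ps) * M) else 0)"
proof -
  have "pauli_coeff n M = (\<lambda>ps. if ps \<in> pauli_strings n
           then ntrace n (mat_adjoint (pauli_string ps) * M) else 0)"
    unfolding pauli_coeff_def using pauli_expansion[OF assms]
    by (intro the1_equality pauli_expansion_unique assms) auto
  then show ?thesis by simp
qed

theorem pauli_sum_coeff: "M \<in> operators n \<Longrightarrow> pauli_sum n (pauli_coeff n M) = M"
  using theI'[OF pauli_expansion_unique, of M n] by (simp add: pauli_coeff_def)

lemma OTOC_real: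
  assumes "U \<in> operators n" "P \<in> operators n" "Q \<in> operators n"
    and "mat_adjoint P = P" "mat_adjoint Q = Q"
  shows "OTOC n U P Q \<in> \<real>"
proof -
  have mult: "X * Y \<in> operators n" if "X \<in> operators n" "Y \<in> operators n" for X Y
    using that by (rule mult_carrier_mat)
  have assoc: "X * Y * Z = X * (Y * Z)"
    if "X \<in> operators n" "Y \<in> operators n" "Z \<in> operators n" for X Y Z
    using that by (rule assoc_mult_mat)
  define V where "V = mat_adjoint U * P * U"
  have V: "V \<in> operators n"
    unfolding V_def using assms by (intro mult_carrier_mat) auto
  have adjV: "mat_adjoint V = V"
    using assms by (simp add: V_def mat_adjoint_mult assoc mult)
  have O: "OTOC n U P Q = ntrace n (V * Q * V * Q)"
    using assms V
    by (simp add: OTOC_def V_def assoc mult)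
  have "mat_adjoint (V * Q * V * Q) = Q * (V * Q * V)"
    using assms V adjV by (simp add: mat_adjoint_mult assoc mult)
  moreover have "mat_trace (Q * (V * Q * V)) = mat_trace (V * Q * V * Q)"
    using assms V by (intro mat_trace_commute) auto
  moreover have "mat_trace (mat_adjoint (V * Q * V * Q)) = cnj (mat_trace (V * Q * V * Q))"
    using assms V by (intro mat_trace_adjoint) auto
  ultimately have "cnj (mat_trace (V * Q * V * Q)) = mat_trace (V * Q * V * Q)"
    by simp
  then have "mat_trace (V * Q * V * Q) \<in> \<real>"
    by (simp add: Reals_cnj_iff)
  then show ?thesis by (simp add: O ntrace_def)
qed

theorem avg_OTOC_eq_fidelity:
  assumes "U \<in> unitaries n"
  shows "avg_OTOC n A D U = complex_of_real (1 / (d\<^sub>A\<^sup>2 * decoding_fidelity n A D U))"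
proof -
  have "OTOC n U (pauli_string q) (pauli_string p) \<in> \<real>"
    if "p \<in> local_paulis n A" "q \<in> local_paulis n D" for p q
    using that assms
    by (intro OTOC_real) (auto simp: unitaries_def local_paulis_def pauli_strings_def)
  then have "avg_OTOC n A D U \<in> \<real>"
    unfolding avg_OTOC_def by (intro Reals_divide sum_in_Reals) auto
  then have "avg_OTOC n A D U = complex_of_real (Re (avg_OTOC n A D U))"
    by simp
  also have "\<dots> = complex_of_real (1 / (d\<^sub>A\<^sup>2 * decoding_fidelity n A D U))"
    by (simp add: decoding_fidelity_def d\<^sub>A_def)
  finally show ?thesis .
qed

lemma pauli_coeff_sum: "ps \<in> pauli_strings n \<Longrightarrow> pauli_coeff n (pauli_sum n c) ps = c ps"
  by (simp add: pauli_coeff_eq ntrace_pauli_sum del: pauli_string_hermitian)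

lemma norm2_pauli_sum: "norm2 n (pauli_sum n c) = sqrt (\<Sum>ps\<in>pauli_strings n. (cmod (c ps))\<^sup>2)"
proof -
  let ?M = "pauli_sum n c"
  have dim: "dim_row ?M = 2 ^ n" "dim_col ?M = 2 ^ n"
    by (simp_all add: pauli_sum_def)
  have "mat_trace (mat_adjoint ?M * ?M) = (\<Sum>j<2 ^ n. \<Sum>i<2 ^ n. cnj (?M $$ (i, j)) * ?M $$ (i, j))"
    by (subst mat_trace_mult) (auto simp: dim intro!: sum.cong)
  also have "\<dots> = (\<Sum>i<2 ^ n. \<Sum>j<2 ^ n. cnj (?M $$ (i, j)) * ?M $$ (i, j))"
    by (rule sum.swap)
  also have "\<dots> = (\<Sum>i<2 ^ n. \<Sum>j<2 ^ n. \<Sum>ps\<in>pauli_strings n.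
      cnj (c ps) * (cnj (pauli_string ps $$ (i, j)) * ?M $$ (i, j)))"
  proof (intro sum.cong refl)
    fix i j :: nat assume "i \<in> {..<2 ^ n}" "j \<in> {..<2 ^ n}"
    then have "cnj (?M $$ (i, j)) = (\<Sum>ps\<in>pauli_strings n. cnj (c ps) * cnj (pauli_string ps $$ (i, j)))"
      by (simp add: pauli_sum_def)
    then show "cnj (?M $$ (i, j)) * ?M $$ (i, j) = (\<Sum>ps\<in>pauli_strings n.
        cnj (c ps) * (cnj (pauli_string ps $$ (i, j)) * ?M $$ (i, j)))"
      by (simp only: sum_distrib_right mult.assoc)
  qed
  also have "\<dots> = (\<Sum>i<2 ^ n. \<Sum>ps\<in>pauli_strings n. \<Sum>j<2 ^ n.
      cnj (c ps) * (cnj (pauli_string ps $$ (i, j)) * ?M $$ (i, j)))"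
    by (intro sum.cong refl sum.swap)
  also have "\<dots> = (\<Sum>ps\<in>pauli_strings n. \<Sum>i<2 ^ n. \<Sum>j<2 ^ n.
      cnj (c ps) * (cnj (pauli_string ps $$ (i, j)) * ?M $$ (i, j)))"
    by (rule sum.swap)
  also have "\<dots> = (\<Sum>ps\<in>pauli_strings n. cnj (c ps) * (2 ^ n * c ps))"
  proof (intro sum.cong refl)
    fix ps assume ps: "ps \<in> pauli_strings n"
    have "c ps = (\<Sum>i<2 ^ n. \<Sum>j<2 ^ n. cnj (pauli_string ps $$ (i, j)) * ?M $$ (i, j)) / 2 ^ n"
      using ntrace_pauli_sum[OF ps, of c] ps
      by (simp add: ntrace_pauli_mult del: pauli_string_hermitian)
    then have "(\<Sum>i<2 ^ n. \<Sum>j<2 ^ n. cnj (pauli_string ps $$ (i, j)) * ?M $$ (i, j)) = 2 ^ n * c ps"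
      by (simp add: field_simps)
    then show "(\<Sum>i<2 ^ n. \<Sum>j<2 ^ n. cnj (c ps) * (cnj (pauli_string ps $$ (i, j)) * ?M $$ (i, j)))
        = cnj (c ps) * (2 ^ n * c ps)"
      by (simp only: sum_distrib_left[symmetric])
  qed
  also have "\<dots> = 2 ^ n * (\<Sum>ps\<in>pauli_strings n. c ps * cnj (c ps))"
    by (simp add: sum_distrib_left mult_ac)
  finally have "ntrace n (mat_adjoint ?M * ?M) = (\<Sum>ps\<in>pauli_strings n. c ps * cnj (c ps))"
    by (simp add: ntrace_def)
  also have "\<dots> = complex_of_real (\<Sum>ps\<in>pauli_strings n. (cmod (c ps))\<^sup>2)"
    by (simp only: complex_norm_square of_real_sum)
  finally show ?thesis by (simp add: norm2_def)
qed

lemma pauli_string_identity: "pauli_string (replicate n Pauli_I) = 1\<^sub>m (2 ^ n)"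
proof (induction n)
  case (Suc n)
  show ?case
  proof (rule eq_matI)
    fix i j assume ij: "i < dim_row (1\<^sub>m (2 ^ Suc n) :: complex mat)" "j < dim_col (1\<^sub>m (2 ^ Suc n) :: complex mat)"
    let ?m = "2 ^ n :: nat"
    have eq: "i = j \<longleftrightarrow> i div ?m = j div ?m \<and> i mod ?m = j mod ?m"
      by (metis div_mult_mod_eq)
    have I: "pauli_mat Pauli_I $$ (a, b) = (if a = b then 1 else 0)" if "a < 2" "b < 2" for a b
      using that by (auto simp: less_2_cases_iff mat_of_rows_list_def)
    have lt: "i div ?m < 2" "j div ?m < 2"
      using ij by (simp_all add: div_less_two)
    show "pauli_string (replicate (Suc n) Pauli_I) $$ (i, j) = 1\<^sub>m (2 ^ Suc n) $$ (i, j)"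
      using ij lt eq
      by (simp add: index_pauli_Cons I Suc.IH del: pauli_string.simps pauli_mat.simps)
  qed (simp_all del: pauli_string.simps)
qed simp

lemma mat_trace_pauli_sum: "mat_trace (pauli_sum n c) = 2 ^ n * c (replicate n Pauli_I)"
proof -
  have "ntrace n (mat_adjoint (pauli_string (replicate n Pauli_I)) * pauli_sum n c) = c (replicate n Pauli_I)"
    by (rule ntrace_pauli_sum) (simp add: pauli_strings_def)
  moreover have "mat_adjoint (1\<^sub>m (2 ^ n) :: complex mat) = 1\<^sub>m (2 ^ n)"
    using pauli_string_hermitian[of "replicate n Pauli_I"] by (simp only: pauli_string_identity)
  ultimately show ?thesis
    by (simp add: pauli_string_identity ntrace_def left_mult_one_mat[OF pauli_sum_carrier] field_simps)
qed

definition unit_square :: "complex set" where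
  "unit_square = (\<lambda>(x, y). complex_of_real x + \<i> * complex_of_real y) ` ({-1..1} \<times> {-1..1})"

lemma compact_unit_square: "compact unit_square"
  unfolding unit_square_def
  by (intro compact_continuous_image compact_Times compact_Icc)
    (auto simp: case_prod_unfold intro!: continuous_intros)

lemma unit_squareI: "cmod z \<le> 1 \<Longrightarrow> z \<in> unit_square"
  unfolding unit_square_def
  using abs_Re_le_cmod[of z] abs_Im_le_cmod[of z]
  by (intro image_eqI[where x = "(Re z, Im z)"]) (auto simp: complex_eq)

definition one_body_coeffs :: "nat \<Rightarrow> (pauli list \<Rightarrow> complex) set" where
  "one_body_coeffs n =
     Pi\<^sub>E UNIV (\<lambda>ps. if ps \<in> pauli_strings n then unit_square else {0})
   \<inter> {c. (\<Sum>ps\<in>pauli_strings n. (cmod (c ps))\<^sup>2) = 1}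
   \<inter> {c. (\<Sum>ps\<in>pauli_strings n. real (pauli_weight ps) * (cmod (c ps))\<^sup>2) = 1}
   \<inter> {c. c (replicate n Pauli_I) = 0}"

lemma compact_one_body_coeffs: "compact (one_body_coeffs n)"
proof -
  have coord: "continuous_on UNIV (\<lambda>c :: pauli list \<Rightarrow> complex. c ps)" for ps
    by (rule continuous_on_product_coordinates)
  have "compactin (product_topology (\<lambda>_. euclidean) UNIV)
      (Pi\<^sub>E UNIV (\<lambda>ps. if ps \<in> pauli_strings n then unit_square else {0 :: complex}))"
    by (auto simp: compactin_PiE compact_unit_square)
  then have "compact (Pi\<^sub>E UNIV (\<lambda>ps. if ps \<in> pauli_strings n then unit_square else {0 :: complex}))"
    by (simp add: euclidean_product_topology)
  then show ?thesis
    unfolding one_body_coeffs_def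
    by (intro compact_Int_closed closed_Collect_eq continuous_intros coord)
qed

lemma one_body_operators_eq: "one_body_operators n = pauli_sum n ` one_body_coeffs n"
proof (intro equalityI subsetI)
  fix M assume "M \<in> one_body_operators n"
  then have M: "M \<in> operators n" "norm2 n M = 1" "avg_weight n M = 1" "mat_trace M = 0"
    by (simp_all add: one_body_operators_def)
  define c where "c = pauli_coeff n M"
  have Mc: "M = pauli_sum n c"
    using M by (simp add: c_def pauli_sum_coeff)
  have sum1: "(\<Sum>ps\<in>pauli_strings n. (cmod (c ps))\<^sup>2) = 1"
    using M(2) unfolding Mc norm2_pauli_sum by simp
  have "c ps \<in> unit_square" if "ps \<in> pauli_strings n" for ps
  proof -
    have "(cmod (c ps))\<^sup>2 \<le> (\<Sum>ps\<in>pauli_strings n. (cmod (c ps))\<^sup>2)"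
      using that by (intro member_le_sum) auto
    then show ?thesis using sum1 by (intro unit_squareI) (simp add: abs_square_le_1)
  qed
  then have "c \<in> one_body_coeffs n"
    using M sum1 mat_trace_pauli_sum[of n c]
    by (auto simp: one_body_coeffs_def avg_weight_def c_def pauli_coeff_eq[OF M(1)] pauli_sum_coeff)
  then show "M \<in> pauli_sum n ` one_body_coeffs n" using Mc by blast
next
  fix M assume "M \<in> pauli_sum n ` one_body_coeffs n"
  then show "M \<in> one_body_operators n"
    by (auto simp: one_body_operators_def one_body_coeffs_def norm2_pauli_sum mat_trace_pauli_sum
        avg_weight_def pauli_coeff_sum)
qed

lemma one_body_coeffs_nonempty:
  assumes "n \<ge> 1"
  shows "one_body_coeffs n \<noteq> {}"
proof -
  obtain m where m: "n = Suc m" using assms by (cases n) auto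
  define qs where "qs = Pauli_X # replicate m Pauli_I"
  define c :: "pauli list \<Rightarrow> complex" where "c = (\<lambda>ps. if ps = qs then 1 else 0)"
  have qs: "qs \<in> pauli_strings n" "pauli_weight qs = 1" "qs \<noteq> replicate n Pauli_I"
    by (simp_all add: qs_def m pauli_strings_def pauli_weight_def)
  have sq: "(cmod (c ps))\<^sup>2 = (if ps = qs then 1 else 0)" for ps
    by (simp add: c_def)
  have "(\<Sum>ps\<in>pauli_strings n. real (pauli_weight ps) * (cmod (c ps))\<^sup>2)
      = (\<Sum>ps\<in>pauli_strings n. if ps = qs then 1 else 0)"
    by (intro sum.cong) (auto simp: sq qs)
  then have "(\<Sum>ps\<in>pauli_strings n. real (pauli_weight ps) * (cmod (c ps))\<^sup>2) = 1"
    using qs by simp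
  moreover have "(\<Sum>ps\<in>pauli_strings n. (cmod (c ps))\<^sup>2) = 1"
    using qs by (simp add: sq)
  moreover have "c (replicate n Pauli_I) = 0" "c ps \<in> unit_square" "ps \<notin> pauli_strings n \<Longrightarrow> c ps = 0" for ps
    using qs by (auto simp: c_def intro!: unit_squareI)
  ultimately have "c \<in> one_body_coeffs n"
    by (auto simp: one_body_coeffs_def)
  then show ?thesis by blast
qed

lemma continuous_on_mat_mult:
  assumes "\<And>c. F c \<in> carrier_mat a b" "\<And>c. G c \<in> carrier_mat b d"
    and "\<And>i j. i < a \<Longrightarrow> j < b \<Longrightarrow> continuous_on S (\<lambda>c. F c $$ (i, j) :: complex)"
    and "\<And>i j. i < b \<Longrightarrow> j < d \<Longrightarrow> continuous_on S (\<lambda>c. G c $$ (i, j))"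
    and "i < a" "j < d"
  shows "continuous_on S (\<lambda>c. (F c * G c) $$ (i, j))"
proof -
  have dim: "dim_row (F c) = a" "dim_col (F c) = b" "dim_row (G c) = b" "dim_col (G c) = d" for c
    using assms(1,2)[of c] by auto
  have "(\<lambda>c. (F c * G c) $$ (i, j)) = (\<lambda>c. \<Sum>k<b. F c $$ (i, k) * G c $$ (k, j))"
    using assms(5,6) by (intro ext) (simp add: scalar_prod_def dim lessThan_atLeast0)
  moreover have "continuous_on S (\<lambda>c. \<Sum>k<b. F c $$ (i, k) * G c $$ (k, j))"
    using assms(3-6) by (intro continuous_intros) auto
  ultimately show ?thesis by (simp only:)
qed

lemma continuous_on_avg_weight:
  assumes U: "U \<in> operators n"
  shows "continuous_on S (\<lambda>c. avg_weight n (mat_adjoint U * pauli_sum n c * U))"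
proof -
  define V where "V c = mat_adjoint U * pauli_sum n c * U" for c
  have V: "V c \<in> operators n" for c
    unfolding V_def using U by (intro mult_carrier_mat) auto
  have coord: "continuous_on S (\<lambda>c :: pauli list \<Rightarrow> complex. c ps)" for ps
    by (rule continuous_on_subset[OF continuous_on_product_coordinates]) simp
  have sum: "continuous_on S (\<lambda>c. pauli_sum n c $$ (i, j))" if "i < 2 ^ n" "j < 2 ^ n" for i j
    using that by (simp add: pauli_sum_def) (intro continuous_intros coord)
  have entry: "continuous_on S (\<lambda>c. V c $$ (i, j))" if "i < 2 ^ n" "j < 2 ^ n" for i j
    unfolding V_def using that U
    by (intro continuous_on_mat_mult[where a = "2 ^ n" and b = "2 ^ n" and d = "2 ^ n"] sum
        continuous_on_const mult_carrier_mat[where n = "2 ^ n"] mat_adjoint_carrier) auto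
  have "continuous_on S (\<lambda>c. pauli_coeff n (V c) ps)" if "ps \<in> pauli_strings n" for ps
    using that V
    by (simp add: pauli_coeff_eq ntrace_pauli_mult del: pauli_string_hermitian)
      (intro continuous_intros entry; simp)
  then show ?thesis
    unfolding avg_weight_def V_def[symmetric] by (intro continuous_intros)
qed

theorem pauli_growth_attained:
  assumes "n \<ge> 1" "U \<in> operators n"
  obtains M where "M \<in> one_body_operators n"
    and "pauli_growth n U = avg_weight n (mat_adjoint U * M * U) - 1"
    and "\<And>N. N \<in> one_body_operators n \<Longrightarrow>
           avg_weight n (mat_adjoint U * N * U) - 1 \<le> avg_weight n (mat_adjoint U * M * U) - 1"
proof -
  obtain c where c: "c \<in> one_body_coeffs n"
    "\<And>d. d \<in> one_body_coeffs n \<Longrightarrow> avg_weight n (mat_adjoint U * pauli_sum n d * U)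
        \<le> avg_weight n (mat_adjoint U * pauli_sum n c * U)"
    using continuous_attains_sup[OF compact_one_body_coeffs one_body_coeffs_nonempty
        continuous_on_avg_weight] assms by metis
  show thesis
  proof (rule that)
    show "pauli_sum n c \<in> one_body_operators n"
      using c by (simp add: one_body_operators_eq)
    show le: "avg_weight n (mat_adjoint U * N * U) - 1
        \<le> avg_weight n (mat_adjoint U * pauli_sum n c * U) - 1" if "N \<in> one_body_operators n" for N
      using that c by (auto simp: one_body_operators_eq)
    show "pauli_growth n U = avg_weight n (mat_adjoint U * pauli_sum n c * U) - 1"
      unfolding pauli_growth_def
      using le c by (intro cSup_eq_maximum) (auto simp: one_body_operators_eq)
  qed
qed

end

theory Submission
  imports Defs
begin

text \<open>For a one-body Pauli operator \<open>Q\<close> on \<open>D\<close>, expand \<open>U\<^sup>\<dagger> Q U\<close> in Pauli operators. Averaging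
  the OTOC over the Pauli operators on \<open>A\<close> annihilates every term that acts on \<open>A\<close>, because such a
  term anticommutes with half of them, and keeps the others. Hence \<open>1 / F\<close> equals \<open>1\<close> plus the sum over
  the three nontrivial \<open>Q\<close> of \<open>1 - w\<^sub>A(Q)\<close>, where \<open>w\<^sub>A(Q)\<close> is the part of the norm supported on \<open>A\<close>.
  Summing \<open>w\<^sub>A(Q)\<close> over all \<open>A \<noteq> D\<close> gives at most the average weight of \<open>U\<^sup>\<dagger> Q U\<close>, which is at most
  \<open>G(U) + 1\<close>. This bounds the average of \<open>1 / F\<close> by \<open>4 - 3 (G(U) + 1) / (n - 1)\<close> from below, and
  \<open>3 / (n - 1) \<le> 4 / n\<close> for \<open>n \<ge> 4\<close>.\<close>

section \<open>Commutation of Pauli operators\<close>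

text \<open>Division with remainder by \<open>m\<close> identifies the indices below
  \<open>n * m\<close> with pairs. Unlike in \<open>sum_div_mod\<close>, the number of blocks is
  arbitrary, as general Kronecker products require.\<close>

lemma sum_div_mod_prod:
  "(\<Sum>i<n * m. f (i div m) (i mod m)) = (\<Sum>a<n. \<Sum>b<m. f a b)" for m n :: nat
proof (cases "m = 0")
  case False
  have lt: "a * m + b < n * m" if "a < n" "b < m" for a b
  proof -
    have "a * m + b < Suc a * m" using that by simp
    also have "\<dots> \<le> n * m" using that by (intro mult_le_mono1) simp
    finally show ?thesis .
  qed
  have "(\<Sum>i<n * m. f (i div m) (i mod m)) = (\<Sum>(a, b)\<in>{..<n} \<times> {..<m}. f a b)"
    using False
    by (intro sum.reindex_bij_witness[where i = "\<lambda>(a, b). a * m + b" and j = "\<lambda>i. (i div m, i mod m)"])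
       (use lt in \<open>auto simp: less_mult_imp_div_less\<close>)
  then show ?thesis by (simp add: sum.cartesian_product)
qed simp

text \<open>Mixed-product property: the contracted index splits into quotient and remainder, and the
  double sum factors.\<close>

lemma kronecker_mult:
  assumes "dim_col A = dim_row C" "dim_col B = dim_row D"
  shows "kronecker A B * kronecker C D = kronecker (A * C) (B * D)"
proof (rule eq_matI)
  fix i j assume "i < dim_row (kronecker (A * C) (B * D))" "j < dim_col (kronecker (A * C) (B * D))"
  then have i: "i < dim_row A * dim_row B" and j: "j < dim_col C * dim_col D"
    by simp_all
  \<comment> \<open>Positive divisors keep the remainders in range as matrix indices.\<close>
  then have pos: "0 < dim_row B" "0 < dim_col D"
    by (auto intro: gr0I)
  let ?a = "\<lambda>k. A $$ (i div dim_row B, k)" and ?b = "\<lambda>k. B $$ (i mod dim_row B, k)"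
  let ?c = "\<lambda>k. C $$ (k, j div dim_col D)" and ?d = "\<lambda>k. D $$ (k, j mod dim_col D)"
  have "(kronecker A B * kronecker C D) $$ (i, j)
      = (\<Sum>k<dim_row C * dim_row D. (\<lambda>s t. (?a s * ?b t) * (?c s * ?d t)) (k div dim_row D) (k mod dim_row D))"
    using i j assms by (simp add: scalar_prod_def lessThan_atLeast0 kronecker_def)
  also have "\<dots> = (\<Sum>s<dim_row C. \<Sum>t<dim_row D. (?a s * ?b t) * (?c s * ?d t))"
    by (rule sum_div_mod_prod)
  also have "\<dots> = (\<Sum>s<dim_row C. ?a s * ?c s) * (\<Sum>t<dim_row D. ?b t * ?d t)"
    by (simp add: sum_product mult_ac)
  also have "\<dots> = kronecker (A * C) (B * D) $$ (i, j)"
    using i j pos assms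
    by (simp add: scalar_prod_def lessThan_atLeast0 kronecker_def less_mult_imp_div_less)
  finally show "(kronecker A B * kronecker C D) $$ (i, j) = kronecker (A * C) (B * D) $$ (i, j)" .
qed simp_all

lemma kronecker_smult: "kronecker (a \<cdot>\<^sub>m A) (b \<cdot>\<^sub>m B) = (a * b) \<cdot>\<^sub>m kronecker A B"
proof (rule eq_matI)
  fix i j assume "i < dim_row ((a * b) \<cdot>\<^sub>m kronecker A B)" "j < dim_col ((a * b) \<cdot>\<^sub>m kronecker A B)"
  then have i: "i < dim_row A * dim_row B" and j: "j < dim_col A * dim_col B"
    by simp_all
  then have "0 < dim_row B" "0 < dim_col B"
    by (auto intro: gr0I)
  then show "kronecker (a \<cdot>\<^sub>m A) (b \<cdot>\<^sub>m B) $$ (i, j) = ((a * b) \<cdot>\<^sub>m kronecker A B) $$ (i, j)"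
    using i j by (simp add: kronecker_def less_mult_imp_div_less)
qed simp_all

text \<open>The value is 1 for commuting and -1 for anticommuting Pauli matrices.\<close>

definition pauli_sign :: "pauli \<Rightarrow> pauli \<Rightarrow> real" where
  "pauli_sign p q = (if p = Pauli_I \<or> q = Pauli_I \<or> p = q then 1 else - 1)"

text \<open>For strings of equal length this is the parity of the number of anticommuting positions,
  hence the sign with which the two tensor products commute.\<close>

definition string_sign :: "pauli list \<Rightarrow> pauli list \<Rightarrow> real" where
  "string_sign ps qs = prod_list (map2 pauli_sign ps qs)"

lemma pauli_mat_conj:
  "pauli_mat p * pauli_mat q * pauli_mat p = complex_of_real (pauli_sign p q) \<cdot>\<^sub>m pauli_mat q"
  by (rule eq_matI; cases p; cases q)
    (auto simp: pauli_sign_def less_Suc_eq mat_of_rows_list_def scalar_prod_def numeral_2_eq_2)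

text \<open>By \<open>kronecker_mult\<close> the conjugation acts on each tensor factor separately,
  and the scalars from \<open>pauli_mat_conj\<close> multiply up.\<close>

lemma pauli_string_conj:
  assumes "length ps = length qs"
  shows "pauli_string ps * pauli_string qs * pauli_string ps
       = complex_of_real (string_sign ps qs) \<cdot>\<^sub>m pauli_string qs"
  using assms
proof (induction ps qs rule: list_induct2)
  case Nil
  show ?case by (rule eq_matI) (auto simp: string_sign_def)
next
  case (Cons p ps q qs)
  then show ?case
    by (simp add: kronecker_mult pauli_mat_conj kronecker_smult string_sign_def)
qed

section \<open>Pauli operators on a single qubit and their signs\<close>

lemma local_paulis_eq:
  assumes "k < n"
  shows "local_paulis n k = (\<lambda>p. (replicate n Pauli_I)[k := p]) ` UNIV"
proof (intro equalityI subsetI)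
  fix ps assume "ps \<in> local_paulis n k"
  then have ps: "length ps = n" "\<And>j. j < n \<Longrightarrow> j \<noteq> k \<Longrightarrow> ps ! j = Pauli_I"
    by (auto simp: local_paulis_def pauli_strings_def)
  have "ps = (replicate n Pauli_I)[k := ps ! k]"
    by (rule nth_equalityI) (use assms in \<open>simp_all add: ps nth_list_update\<close>)
  then show "ps \<in> (\<lambda>p. (replicate n Pauli_I)[k := p]) ` UNIV" by blast
qed (use assms in \<open>auto simp: local_paulis_def pauli_strings_def\<close>)

lemma inj_local_pauli: "k < n \<Longrightarrow> inj (\<lambda>p. (replicate n Pauli_I)[k := p])"
  by (rule injI) (metis length_replicate nth_list_update_eq)

lemma sum_local_paulis:
  "k < n \<Longrightarrow> (\<Sum>ps\<in>local_paulis n k. f ps) = (\<Sum>p\<in>UNIV. f ((replicate n Pauli_I)[k := p]))"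
  by (simp add: local_paulis_eq sum.reindex inj_local_pauli)

lemma card_local_paulis: "k < n \<Longrightarrow> card (local_paulis n k) = 4"
  using card_image[OF inj_local_pauli, of k n] by (simp add: local_paulis_eq) (simp add: UNIV_pauli)

lemma string_sign_identity: "string_sign (replicate n Pauli_I) qs = 1"
  by (induction n arbitrary: qs; case_tac qs) (auto simp: string_sign_def pauli_sign_def)

lemma string_sign_local:
  assumes "k < length qs"
  shows "string_sign ((replicate (length qs) Pauli_I)[k := p]) qs = pauli_sign p (qs ! k)"
  using assms
proof (induction qs arbitrary: k)
  case (Cons q qs)
  have "string_sign (r # rs) (q # qs) = pauli_sign r q * string_sign rs qs" for r rs
    by (simp add: string_sign_def)
  then show ?case
    using Cons by (cases k) (auto simp: string_sign_identity pauli_sign_def[of Pauli_I])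
qed simp

text \<open>A nontrivial Pauli matrix commutes with the identity and itself and anticommutes with
  the other two, so its four signs cancel; the identity commutes with all four.\<close>

lemma sum_string_sign_local:
  assumes "k < n" "qs \<in> pauli_strings n"
  shows "(\<Sum>ps\<in>local_paulis n k. string_sign ps qs) = (if qs ! k = Pauli_I then 4 else 0)"
proof -
  have "(\<Sum>ps\<in>local_paulis n k. string_sign ps qs) = (\<Sum>p\<in>UNIV. pauli_sign p (qs ! k))"
    unfolding sum_local_paulis[OF assms(1)]
    using assms string_sign_local[of k qs] by (intro sum.cong) (auto simp: pauli_strings_def)
  then show ?thesis by (cases "qs ! k") (simp_all add: UNIV_pauli pauli_sign_def)
qed

text \<open>Conjugation of the identity string, for which every sign is 1.\<close>

lemma pauli_string_square: "pauli_string ps * pauli_string ps = 1\<^sub>m (2 ^ length ps)"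
proof -
  have "pauli_string ps * 1\<^sub>m (2 ^ length ps) * pauli_string ps = 1\<^sub>m (2 ^ length ps)"
  proof -
    have "1 \<cdot>\<^sub>m 1\<^sub>m (2 ^ length ps) = (1\<^sub>m (2 ^ length ps) :: complex mat)"
      by (rule eq_matI) auto
    then show ?thesis
      using pauli_string_conj[of ps "replicate (length ps) Pauli_I"]
      by (simp add: pauli_string_identity string_sign_def pauli_sign_def zip_replicate2 o_def map_replicate_const)
  qed
  then show ?thesis
    by (simp add: right_mult_one_mat[of _ "2 ^ length ps" "2 ^ length ps"] carrier_matI)
qed

section \<open>Out-of-time-order correlators in the Pauli basis\<close>

text \<open>Parseval's identity for the Pauli basis: only \<open>M\<close> is expanded, and the
  remaining inner sums are the coefficients of \<open>N\<close>.\<close>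

lemma ntrace_adjoint_mult:
  assumes "M \<in> operators n" "N \<in> operators n"
  shows "ntrace n (mat_adjoint M * N) = (\<Sum>ps\<in>pauli_strings n. cnj (pauli_coeff n M ps) * pauli_coeff n N ps)"
proof -
  let ?c = "pauli_coeff n M"
  have dim: "dim_row M = 2 ^ n" "dim_col M = 2 ^ n" "dim_row N = 2 ^ n" "dim_col N = 2 ^ n"
    using assms by auto
  have entry: "M $$ (i, j) = (\<Sum>ps\<in>pauli_strings n. ?c ps * pauli_string ps $$ (i, j))"
    if "i < 2 ^ n" "j < 2 ^ n" for i j
  proof -
    have "M $$ (i, j) = pauli_sum n ?c $$ (i, j)" by (simp add: pauli_sum_coeff assms)
    then show ?thesis using that by (simp add: pauli_sum_def)
  qed
  have "mat_trace (mat_adjoint M * N) = (\<Sum>j<2 ^ n. \<Sum>i<2 ^ n. cnj (M $$ (i, j)) * N $$ (i, j))"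
    by (subst mat_trace_mult) (auto simp: dim intro!: sum.cong)
  also have "\<dots> = (\<Sum>i<2 ^ n. \<Sum>j<2 ^ n. cnj (M $$ (i, j)) * N $$ (i, j))"
    by (rule sum.swap)
  also have "\<dots> = (\<Sum>i<2 ^ n. \<Sum>j<2 ^ n. \<Sum>ps\<in>pauli_strings n.
      cnj (?c ps) * (cnj (pauli_string ps $$ (i, j)) * N $$ (i, j)))"
    by (intro sum.cong refl) (simp add: entry sum_distrib_right mult.assoc)
  also have "\<dots> = (\<Sum>i<2 ^ n. \<Sum>ps\<in>pauli_strings n. \<Sum>j<2 ^ n.
      cnj (?c ps) * (cnj (pauli_string ps $$ (i, j)) * N $$ (i, j)))"
    by (intro sum.cong refl sum.swap)
  also have "\<dots> = (\<Sum>ps\<in>pauli_strings n. \<Sum>i<2 ^ n. \<Sum>j<2 ^ n.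
      cnj (?c ps) * (cnj (pauli_string ps $$ (i, j)) * N $$ (i, j)))"
    by (rule sum.swap)
  also have "\<dots> = (\<Sum>ps\<in>pauli_strings n. cnj (?c ps) *
      (\<Sum>i<2 ^ n. \<Sum>j<2 ^ n. cnj (pauli_string ps $$ (i, j)) * N $$ (i, j)))"
    by (simp only: sum_distrib_left)
  also have "\<dots> / 2 ^ n = (\<Sum>ps\<in>pauli_strings n. cnj (?c ps) * pauli_coeff n N ps)"
    using assms by (subst sum_divide_distrib, intro sum.cong refl)
      (simp add: pauli_coeff_eq[OF assms(2)] ntrace_pauli_mult del: pauli_string_hermitian)
  finally show ?thesis by (simp add: ntrace_def)
qed

lemma mat_trace_smult: "mat_trace (a \<cdot>\<^sub>m M) = a * mat_trace M" if "dim_row M = dim_col M"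
  using that by (simp add: mat_trace_def sum_distrib_left)

lemma assoc_operators:
  "X \<in> operators n \<Longrightarrow> Y \<in> operators n \<Longrightarrow> Z \<in> operators n \<Longrightarrow> X * Y * Z = X * (Y * Z)"
  by (rule assoc_mult_mat)

lemma mult_operators: "X \<in> operators n \<Longrightarrow> Y \<in> operators n \<Longrightarrow> X * Y \<in> operators n"
  by (rule mult_carrier_mat)

lemma adjoint_operators_mult:
  "X \<in> operators n \<Longrightarrow> Y \<in> operators n \<Longrightarrow> mat_adjoint (X * Y) = mat_adjoint Y * mat_adjoint X"
  by (intro mat_adjoint_mult) auto

text \<open>Cyclicity of the trace moves the conjugation from \<open>M\<close> to the basis string,
  where it is a sign. Thus conjugation by a Pauli operator is diagonal in the Pauli basis.\<close>

lemma pauli_coeff_conj: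
  assumes M: "M \<in> operators n" and qs: "qs \<in> pauli_strings n" and ps: "ps \<in> pauli_strings n"
  shows "pauli_coeff n (pauli_string qs * M * pauli_string qs) ps = string_sign qs ps * pauli_coeff n M ps"
proof -
  let ?P = "pauli_string ps" and ?Q = "pauli_string qs"
  have P: "?P \<in> operators n" and Q: "?Q \<in> operators n"
    using ps qs by (simp_all add: pauli_string_carrier)
  have "mat_trace (?P * (?Q * M * ?Q)) = mat_trace ((?P * (?Q * M)) * ?Q)"
    using P Q M by (simp add: assoc_operators mult_operators)
  also have "\<dots> = mat_trace (?Q * (?P * (?Q * M)))"
    using carrier_matD[OF P] carrier_matD[OF Q] carrier_matD[OF M]
    by (intro mat_trace_commute) (simp_all del: dim_pauli_string)
  also have "?Q * (?P * (?Q * M)) = (?Q * ?P * ?Q) * M"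
    using P Q M by (simp add: assoc_operators mult_operators)
  also have "\<dots> = complex_of_real (string_sign qs ps) \<cdot>\<^sub>m (?P * M)"
    using ps qs P M
    by (simp add: pauli_string_conj pauli_strings_def mult_smult_assoc_mat[of _ "2 ^ n" "2 ^ n" _ "2 ^ n"])
  also have "mat_trace \<dots> = string_sign qs ps * mat_trace (?P * M)"
    using P M by (intro mat_trace_smult) auto
  finally show ?thesis
    using M Q ps by (simp add: pauli_coeff_eq mult_operators ntrace_def)
qed

text \<open>Since \<open>M\<close> is Hermitian, the trace is the inner product of \<open>M\<close>
  with its conjugate by the Pauli operator, so Parseval's identity applies.\<close>

lemma ntrace_hermitian_conj:
  assumes "M \<in> operators n" "mat_adjoint M = M" "qs \<in> pauli_strings n"
  shows "ntrace n (M * pauli_string qs * M * pauli_string qs)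
       = complex_of_real (\<Sum>ps\<in>pauli_strings n. string_sign qs ps * (cmod (pauli_coeff n M ps))\<^sup>2)"
proof -
  let ?Q = "pauli_string qs"
  have Q: "?Q \<in> operators n" using assms by (simp add: pauli_string_carrier)
  have "M * ?Q * M * ?Q = mat_adjoint M * (?Q * M * ?Q)"
    using assms Q by (simp add: assoc_operators mult_operators)
  also have "ntrace n \<dots> = (\<Sum>ps\<in>pauli_strings n. cnj (pauli_coeff n M ps) * pauli_coeff n (?Q * M * ?Q) ps)"
    using assms Q by (intro ntrace_adjoint_mult mult_operators) auto
  also have "\<dots> = (\<Sum>ps\<in>pauli_strings n. string_sign qs ps * (pauli_coeff n M ps * cnj (pauli_coeff n M ps)))"
    using assms by (intro sum.cong refl) (simp add: pauli_coeff_conj)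
  finally show ?thesis
    by (simp add: complex_norm_square[symmetric])
qed

text \<open>Once the sums are exchanged, the signs of each \<open>ps\<close> add up to 4 or 0
  according to its factor at \<open>A\<close>.\<close>

lemma sum_local_OTOC:
  assumes U: "U \<in> unitaries n" and A: "A < n" and qs: "qs \<in> pauli_strings n"
  shows "(\<Sum>p\<in>local_paulis n A. OTOC n U (pauli_string qs) (pauli_string p))
       = complex_of_real (4 * (\<Sum>ps | ps \<in> pauli_strings n \<and> ps ! A = Pauli_I.
           (cmod (pauli_coeff n (mat_adjoint U * pauli_string qs * U) ps))\<^sup>2))"
proof -
  let ?Q = "pauli_string qs"
  let ?V = "mat_adjoint U * ?Q * U"
  let ?c = "\<lambda>ps. (cmod (pauli_coeff n ?V ps))\<^sup>2"
  have Uc: "U \<in> operators n" using U by (simp add: unitaries_def)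
  have Q: "?Q \<in> operators n" using qs by (rule pauli_string_carrier)
  have V: "?V \<in> operators n" using Uc Q by (intro mult_operators) auto
  have adj: "mat_adjoint ?V = ?V"
    using Uc Q by (simp add: adjoint_operators_mult[of _ n] assoc_operators[of _ n] mult_operators)
  have "OTOC n U ?Q (pauli_string p) = complex_of_real (\<Sum>ps\<in>pauli_strings n. string_sign p ps * ?c ps)"
    if "p \<in> local_paulis n A" for p
  proof -
    have p: "p \<in> pauli_strings n" using that by (simp add: local_paulis_def)
    have "OTOC n U ?Q (pauli_string p) = ntrace n (?V * pauli_string p * ?V * pauli_string p)"
      using Uc Q pauli_string_carrier[OF p] by (simp add: OTOC_def assoc_operators[of _ n] mult_operators)
    then show ?thesis using ntrace_hermitian_conj[OF V adj p] by simp
  qed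
  then have "(\<Sum>p\<in>local_paulis n A. OTOC n U ?Q (pauli_string p))
      = complex_of_real (\<Sum>p\<in>local_paulis n A. \<Sum>ps\<in>pauli_strings n. string_sign p ps * ?c ps)"
    by simp
  also have "(\<Sum>p\<in>local_paulis n A. \<Sum>ps\<in>pauli_strings n. string_sign p ps * ?c ps)
      = (\<Sum>ps\<in>pauli_strings n. (\<Sum>p\<in>local_paulis n A. string_sign p ps) * ?c ps)"
    unfolding sum_distrib_right by (rule sum.swap)
  also have "\<dots> = (\<Sum>ps\<in>pauli_strings n. if ps ! A = Pauli_I then 4 * ?c ps else 0)"
    using A by (intro sum.cong refl) (simp add: sum_string_sign_local)
  also have "\<dots> = 4 * (\<Sum>ps | ps \<in> pauli_strings n \<and> ps ! A = Pauli_I. ?c ps)"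
    by (simp add: sum.inter_filter[symmetric] sum_distrib_left)
  finally show ?thesis .
qed

text \<open>The conjugated string is again unitary, hence of normalised norm 1, and Parseval's
  identity turns this into a sum of coefficients.\<close>

lemma sum_cmod_pauli_coeff_conj:
  assumes U: "U \<in> unitaries n" and qs: "qs \<in> pauli_strings n"
  shows "(\<Sum>ps\<in>pauli_strings n. (cmod (pauli_coeff n (mat_adjoint U * pauli_string qs * U) ps))\<^sup>2) = 1"
proof -
  let ?Q = "pauli_string qs"
  let ?V = "mat_adjoint U * ?Q * U"
  have Uc: "U \<in> operators n" and UU: "U * mat_adjoint U = 1\<^sub>m (2 ^ n)" "mat_adjoint U * U = 1\<^sub>m (2 ^ n)"
    using U by (simp_all add: unitaries_def)
  have Q: "?Q \<in> operators n" using qs by (rule pauli_string_carrier)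
  have V: "?V \<in> operators n" using Uc Q by (intro mult_operators) auto
  have "mat_adjoint ?V * ?V = mat_adjoint U * (?Q * ((U * mat_adjoint U) * (?Q * U)))"
    using Uc Q by (simp add: adjoint_operators_mult[of _ n] assoc_operators[of _ n] mult_operators)
  also have "\<dots> = mat_adjoint U * ((?Q * ?Q) * U)"
    using Uc Q by (simp add: UU assoc_operators mult_operators left_mult_one_mat[of _ "2 ^ n" "2 ^ n"])
  also have "\<dots> = 1\<^sub>m (2 ^ n)"
    using Uc qs by (simp add: pauli_string_square pauli_strings_def UU left_mult_one_mat[of _ "2 ^ n" "2 ^ n"])
  finally have "ntrace n (mat_adjoint ?V * ?V) = 1"
    by (simp add: ntrace_def mat_trace_def)
  then have "complex_of_real (\<Sum>ps\<in>pauli_strings n. (cmod (pauli_coeff n ?V ps))\<^sup>2) = 1"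
    unfolding ntrace_adjoint_mult[OF V V] of_real_sum complex_norm_square by (simp add: mult.commute)
  then show ?thesis by (simp only: of_real_eq_1_iff)
qed

section \<open>The fidelity in terms of local weights\<close>

text \<open>Known as the influence of qubit \<open>k\<close> in the analysis of quantum Boolean
  functions.\<close>

definition local_weight :: "nat \<Rightarrow> nat \<Rightarrow> complex mat \<Rightarrow> real" where
  "local_weight n k M = (\<Sum>ps | ps \<in> pauli_strings n \<and> ps ! k \<noteq> Pauli_I. (cmod (pauli_coeff n M ps))\<^sup>2)"

lemma local_weight_nonneg: "0 \<le> local_weight n k M"
  unfolding local_weight_def by (intro sum_nonneg) simp

text \<open>Double counting: the Pauli weight of a string is the number of positions
  \<open>k\<close> at which it is nontrivial.\<close>

lemma avg_weight_eq_sum_local_weight: "avg_weight n M = (\<Sum>k<n. local_weight n k M)"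
proof -
  let ?c = "\<lambda>ps. (cmod (pauli_coeff n M ps))\<^sup>2"
  have "(\<Sum>k<n. local_weight n k M) = (\<Sum>k<n. \<Sum>ps\<in>pauli_strings n. if ps ! k \<noteq> Pauli_I then ?c ps else 0)"
    unfolding local_weight_def by (intro sum.cong refl sum.inter_filter) simp
  also have "\<dots> = (\<Sum>ps\<in>pauli_strings n. \<Sum>k<n. if ps ! k \<noteq> Pauli_I then ?c ps else 0)"
    by (rule sum.swap)
  also have "\<dots> = (\<Sum>ps\<in>pauli_strings n. real (pauli_weight ps) * ?c ps)"
  proof (intro sum.cong refl)
    fix ps assume "ps \<in> pauli_strings n"
    then have w: "pauli_weight ps = card {k \<in> {..<n}. ps ! k \<noteq> Pauli_I}"
      by (simp add: pauli_weight_def length_filter_conv_card pauli_strings_def)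
    show "(\<Sum>k<n. if ps ! k \<noteq> Pauli_I then ?c ps else 0) = real (pauli_weight ps) * ?c ps"
      unfolding w by (subst sum.inter_filter[symmetric]) simp_all
  qed
  finally show ?thesis by (simp add: avg_weight_def)
qed

text \<open>The two averages divide by 16, \<open>sum_local_OTOC\<close> gives a factor 4, and the
  squared dimension of \<open>A\<close> gives the other 4. The sum over \<open>qs\<close> includes
  the identity on \<open>D\<close>.\<close>

lemma inverse_decoding_fidelity:
  assumes U: "U \<in> unitaries n" and A: "A < n" and D: "D < n"
  shows "1 / decoding_fidelity n A D U
       = (\<Sum>qs\<in>local_paulis n D. 1 - local_weight n A (mat_adjoint U * pauli_string qs * U))"
proof -
  let ?V = "\<lambda>qs. mat_adjoint U * pauli_string qs * U"
  have sum: "(\<Sum>p\<in>local_paulis n A. OTOC n U (pauli_string qs) (pauli_string p))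
      = complex_of_real (4 * (1 - local_weight n A (?V qs)))" if "qs \<in> local_paulis n D" for qs
  proof -
    have qs: "qs \<in> pauli_strings n" using that by (simp add: local_paulis_def)
    let ?c = "\<lambda>ps. (cmod (pauli_coeff n (?V qs) ps))\<^sup>2"
    have "(\<Sum>ps | ps \<in> pauli_strings n \<and> ps ! A = Pauli_I. ?c ps) + local_weight n A (?V qs)
        = (\<Sum>ps\<in>pauli_strings n. ?c ps)"
      unfolding local_weight_def
      by (subst sum.union_disjoint[symmetric]) (auto intro!: sum.cong)
    then have "(\<Sum>ps | ps \<in> pauli_strings n \<and> ps ! A = Pauli_I. ?c ps) = 1 - local_weight n A (?V qs)"
      using sum_cmod_pauli_coeff_conj[OF U qs] by simp
    then show ?thesis using sum_local_OTOC[OF U A qs] by simp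
  qed
  have "(\<Sum>p\<in>local_paulis n A. \<Sum>q\<in>local_paulis n D. OTOC n U (pauli_string q) (pauli_string p))
      = (\<Sum>q\<in>local_paulis n D. complex_of_real (4 * (1 - local_weight n A (?V q))))"
    by (subst sum.swap) (intro sum.cong refl sum)
  also have "\<dots> = complex_of_real (4 * (\<Sum>q\<in>local_paulis n D. 1 - local_weight n A (?V q)))"
    by (simp only: of_real_sum sum_distrib_left)
  finally have "avg_OTOC n A D U = complex_of_real ((\<Sum>q\<in>local_paulis n D. 1 - local_weight n A (?V q)) / 4)"
    using A D by (simp add: avg_OTOC_def card_local_paulis)
  \<comment> \<open>In HOL \<open>1 / (1 / x) = x\<close> holds at 0 as well, so inverting the
    fidelity takes no case distinction.\<close>
  then show ?thesis by (simp only: decoding_fidelity_def d\<^sub>A_def Re_complex_of_real) simp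
qed

section \<open>The Pauli growth bound\<close>

text \<open>A real supremum dominates its elements only if the set is bounded above; attainment of
  the maximum provides this.\<close>

lemma avg_weight_le_pauli_growth:
  assumes "n \<ge> 1" "U \<in> operators n" "M \<in> one_body_operators n"
  shows "avg_weight n (mat_adjoint U * M * U) \<le> pauli_growth n U + 1"
proof -
  obtain N where "pauli_growth n U = avg_weight n (mat_adjoint U * N * U) - 1"
    "avg_weight n (mat_adjoint U * M * U) - 1 \<le> avg_weight n (mat_adjoint U * N * U) - 1"
    using pauli_growth_attained[OF assms(1,2)] assms(3) by metis
  then show ?thesis by linarith
qed

section \<open>Pauli strings as one-body operators\<close>

lemma pauli_string_eq_pauli_sum:
  assumes "qs \<in> pauli_strings n"
  shows "pauli_string qs = pauli_sum n (\<lambda>ps. if ps = qs then 1 else 0)"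
proof (rule eq_matI)
  fix i j assume ij: "i < dim_row (pauli_sum n (\<lambda>ps. if ps = qs then 1 else 0))"
    "j < dim_col (pauli_sum n (\<lambda>ps. if ps = qs then 1 else 0))"
  have "(\<Sum>ps\<in>pauli_strings n. (if ps = qs then 1 else 0) * pauli_string ps $$ (i, j))
      = (\<Sum>ps\<in>pauli_strings n. if ps = qs then pauli_string ps $$ (i, j) else 0)"
    by (intro sum.cong) auto
  then show "pauli_string qs $$ (i, j) = pauli_sum n (\<lambda>ps. if ps = qs then 1 else 0) $$ (i, j)"
    using ij assms by (simp add: pauli_sum_def)
qed (use assms in \<open>auto simp: pauli_sum_def pauli_strings_def\<close>)

lemma pauli_coeff_pauli_string:
  assumes "qs \<in> pauli_strings n" "ps \<in> pauli_strings n"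
  shows "pauli_coeff n (pauli_string qs) ps = (if ps = qs then 1 else 0)"
  using assms by (simp add: pauli_string_eq_pauli_sum pauli_coeff_sum)

text \<open>This admits the nontrivial Pauli operators on \<open>D\<close> to the supremum defining
  the growth.\<close>

lemma pauli_string_one_body:
  assumes qs: "qs \<in> pauli_strings n" and w: "pauli_weight qs = 1"
  shows "pauli_string qs \<in> one_body_operators n"
proof -
  have sum: "(\<Sum>ps\<in>pauli_strings n. f ps * (cmod (if ps = qs then 1 else 0))\<^sup>2) = f qs"
    for f :: "pauli list \<Rightarrow> real"
  proof -
    have "(\<Sum>ps\<in>pauli_strings n. f ps * (cmod (if ps = qs then 1 else 0))\<^sup>2)
        = (\<Sum>ps\<in>pauli_strings n. if ps = qs then f ps else 0)"
      by (intro sum.cong) auto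
    then show ?thesis using qs by simp
  qed
  \<comment> \<open>The trace of a Pauli sum only sees the coefficient of the identity
    string.\<close>
  have "replicate n Pauli_I \<noteq> qs" using w by (auto simp: pauli_weight_def)
  then have "mat_trace (pauli_string qs) = 0"
    using qs by (simp add: pauli_string_eq_pauli_sum mat_trace_pauli_sum)
  moreover have "norm2 n (pauli_string qs) = 1"
    unfolding pauli_string_eq_pauli_sum[OF qs] norm2_pauli_sum using sum[of "\<lambda>_. 1"] by simp
  moreover have "avg_weight n (pauli_string qs) = 1"
    using qs w sum[of "\<lambda>ps. real (pauli_weight ps)"]
    by (simp add: avg_weight_def pauli_coeff_pauli_string cong: sum.cong)
  ultimately show ?thesis
    using qs by (simp add: one_body_operators_def pauli_string_carrier)
qed

lemma pauli_weight_local: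
  assumes "k < n" "p \<noteq> Pauli_I"
  shows "pauli_weight ((replicate n Pauli_I)[k := p]) = 1"
proof -
  have "{j. j < n \<and> (replicate n Pauli_I)[k := p] ! j \<noteq> Pauli_I} = {k}"
    using assms by (auto simp: nth_list_update split: if_splits)
  then show ?thesis by (simp add: pauli_weight_def length_filter_conv_card)
qed

text \<open>Each of the four Pauli operators on \<open>D\<close> contributes \<open>n - 1\<close>,
  and only the three nontrivial ones lose local weight.\<close>

lemma sum_inverse_decoding_fidelity_ge:
  assumes U: "U \<in> unitaries n" and n: "n \<ge> 1"
  shows "(\<Sum>A<n - 1. 1 / decoding_fidelity n A (n - 1) U) \<ge> 4 * real (n - 1) - 3 * (pauli_growth n U + 1)"
proof -
  define V where "V p = mat_adjoint U * pauli_string ((replicate n Pauli_I)[n - 1 := p]) * U" for p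
  have Uc: "U \<in> operators n" and UU: "mat_adjoint U * U = 1\<^sub>m (2 ^ n)"
    using U by (simp_all add: unitaries_def)
  have V_I: "V Pauli_I = 1\<^sub>m (2 ^ n)"
  proof -
    have "(replicate n Pauli_I)[n - 1 := Pauli_I] = replicate n Pauli_I"
      by (rule nth_equalityI) (auto simp: nth_list_update)
    then show ?thesis
      using Uc by (simp add: V_def pauli_string_identity UU right_mult_one_mat[of _ "2 ^ n" "2 ^ n"])
  qed
  \<comment> \<open>The identity on \<open>D\<close> is fixed by the evolution and has no weight
    anywhere.\<close>
  have I: "local_weight n A (V Pauli_I) = 0" if "A < n" for A
    unfolding local_weight_def
  proof (intro sum.neutral ballI)
    fix ps assume "ps \<in> {ps \<in> pauli_strings n. ps ! A \<noteq> Pauli_I}"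
    then have ps: "ps \<in> pauli_strings n" "ps \<noteq> replicate n Pauli_I"
      using that by auto
    have "V Pauli_I = pauli_string (replicate n Pauli_I)"
      by (simp add: V_I pauli_string_identity)
    then show "(cmod (pauli_coeff n (V Pauli_I) ps))\<^sup>2 = 0"
      using ps pauli_coeff_pauli_string[of "replicate n Pauli_I" n ps] by (simp add: pauli_strings_def)
  qed
  have sum_le: "(\<Sum>A<n - 1. local_weight n A (V p)) \<le> (if p = Pauli_I then 0 else pauli_growth n U + 1)" for p
  proof (cases "p = Pauli_I")
    case False
    \<comment> \<open>The added term is the nonnegative weight on \<open>D\<close> itself, qubit
      \<open>n - 1\<close>.\<close>
    have "(\<Sum>A<n - 1. local_weight n A (V p)) \<le> (\<Sum>A<n. local_weight n A (V p))"
      by (intro sum_mono2) (auto simp: local_weight_nonneg)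
    also have "\<dots> = avg_weight n (V p)" by (simp add: avg_weight_eq_sum_local_weight)
    also have "\<dots> \<le> pauli_growth n U + 1"
      unfolding V_def using n False
      by (intro avg_weight_le_pauli_growth Uc pauli_string_one_body pauli_weight_local)
        (auto simp: pauli_strings_def)
    finally show ?thesis using False by simp
  qed (simp add: I)
  have "(\<Sum>A<n - 1. 1 / decoding_fidelity n A (n - 1) U) = (\<Sum>A<n - 1. \<Sum>p\<in>UNIV. 1 - local_weight n A (V p))"
    using n by (intro sum.cong refl) (simp add: inverse_decoding_fidelity[OF U] sum_local_paulis V_def)
  also have "\<dots> = (\<Sum>p\<in>UNIV. real (n - 1) - (\<Sum>A<n - 1. local_weight n A (V p)))"
    by (subst sum.swap) (simp add: sum_subtractf)
  also have "\<dots> \<ge> (\<Sum>p\<in>UNIV. real (n - 1) - (if p = Pauli_I then 0 else pauli_growth n U + 1))"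
    by (intro sum_mono diff_left_mono sum_le)
  finally show ?thesis by (simp add: UNIV_pauli)
qed

text \<open>The large \<open>n\<close> limit is read as validity for all sufficiently large
  \<open>n\<close>, with a threshold independent of \<open>U\<close>. The qubits
  \<open>A < n - 1\<close> are exactly those other than \<open>D\<close>.\<close>

theorem theorem3:
  shows "\<forall>\<^sub>F n in sequentially. \<forall>U\<in>unitaries n.
    (\<Sum>A<n - 1. 1 / decoding_fidelity n A (n - 1) U) / real (n - 1)
      \<ge> (d\<^sub>A\<^sup>2 - 1) * (1 - 4 / (3 * real n) * (pauli_growth n U + 1)) + 1"
  using eventually_ge_at_top[of 4]
proof eventually_elim
  case (elim n)
  show ?case
  proof
    fix U assume U: "U \<in> unitaries n"
    let ?g = "pauli_growth n U + 1"
    \<comment> \<open>Replacing \<open>3 / (n - 1)\<close> by \<open>4 / n\<close> as the factor of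
      \<open>?g\<close> requires \<open>?g\<close> to be nonnegative; it is an average weight
      because the maximum is attained.\<close>
    have "U \<in> operators n" "1 \<le> n" using U elim by (auto simp: unitaries_def)
    then obtain M where "pauli_growth n U = avg_weight n (mat_adjoint U * M * U) - 1"
      using pauli_growth_attained[of n U] by metis
    then have g: "0 \<le> ?g" by (simp add: avg_weight_def sum_nonneg)
    have "3 / real (n - 1) \<le> 4 / real n"
      using elim by (simp add: field_simps of_nat_diff)
    have "(d\<^sub>A\<^sup>2 - 1) * (1 - 4 / (3 * real n) * ?g) + 1 = 4 - 4 / real n * ?g"
      using elim by (simp add: d\<^sub>A_def field_simps)
    also have "\<dots> \<le> 4 - 3 / real (n - 1) * ?g"
      using g \<open>3 / real (n - 1) \<le> 4 / real n\<close> by (intro diff_left_mono mult_right_mono)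
    also have "\<dots> = (4 * real (n - 1) - 3 * ?g) / real (n - 1)"
    proof -
      have "real (n - 1) \<noteq> 0" using elim by simp
      then show ?thesis by (simp add: diff_divide_distrib del: of_nat_diff)
    qed
    also have "\<dots> \<le> (\<Sum>A<n - 1. 1 / decoding_fidelity n A (n - 1) U) / real (n - 1)"
      using sum_inverse_decoding_fidelity_ge[OF U] elim by (intro divide_right_mono) auto
    finally show "(d\<^sub>A\<^sup>2 - 1) * (1 - 4 / (3 * real n) * ?g) + 1
        \<le> (\<Sum>A<n - 1. 1 / decoding_fidelity n A (n - 1) U) / real (n - 1)" .
  qed
qed

end
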